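(* Let $k \geqslant 2$ be a fixed integer. There exists $n_0 = n_0(k)$ such that for every integer $n \geqslant n_0$ and every positive integer $q$ the following hold for the $(1:q)$ Waiter--Client non--2--colourability game played on the edge set $E(K_n^{(k)})$ of the complete $k$--uniform hypergraph $K_n^{(k)}$ on $n$ vertices. (i) If $q \leqslant \binom{\lceil n/2\rceil}{k}\frac{\ln 2}{2((1+\ln 2)n+\ln 2)}$, then Waiter has a strategy that forces Client to build a non--2--colourable hypergraph (that is, Waiter has a winning strategy). (ii) If $q \geqslant 2^{k/2}e^{k/2+1}k\binom{n}{k}/n$, then Client has a strategy that keeps his hypergraph 2--colourable throughout the game (that is, Client has a winning strategy).
   Context: $K_n^{(k)}$ is the hypergraph on $n$ vertices whose edges are all $k$-element subsets of the vertex set. For a set $F\subseteq E(K_n^{(k)})$, the weak chromatic number $\chi(F)$ is the smallest integer $r$ such that $V(K_n^{(k)})$ can be partitioned into $r$ independent sets, where a set of vertices is independent if it contains no edge of $F$ entirely. The hypergraph with vertex set $V(K_n^{(k)})$ and edge set $F$ is 2--colourable if $\chi(F)\leqslant 2$, and non--2--colourable if $\chi(F)>2$. The $(1:q)$ Waiter--Client game $(X,\mathcal{F})$, where $X$ is a finite set (the board), $\mathcal{F}\subseteq 2^X$ is the family of winning sets and $q$ is a positive integer, is the following two--player perfect information game. At the beginning of each round, Waiter offers Client exactly $q+1$ free (that is, previously unclaimed) elements of $X$ of Waiter's choice. Client claims one of these, and the remaining $q$ offered elements are claimed by Waiter. If in the last round only $1\leqslant r<q+1$ free elements remain, Waiter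 claims all of them. The game ends when all elements of $X$ are claimed. Waiter wins if Client has fully claimed some winning set in $\mathcal{F}$; otherwise Client wins. The non--2--colourability game has board $X=E(K_n^{(k)})$ and winning sets $\mathcal{NC}_2=\{F\subseteq E(K_n^{(k)}):\chi(F)>2\}$. Client's hypergraph is the hypergraph with vertex set $V(K_n^{(k)})$ whose edges are those claimed by Client. Here $e$ is the base of the natural logarithm. *)

theory Defs
  imports Complex_Main "HOL-Library.Disjoint_Sets" "HOL-Library.Ramsey"
begin

section \<open>Weak colourings of hypergraphs\<close>

text \<open>A hypergraph is given by its vertex set \<open>V\<close> and its edge set \<open>F\<close>;
  the edge set of the complete \<open>k\<close>-uniform hypergraph on \<open>V\<close> is \<open>nsets V k\<close>.\<close>

definition independent_in :: "'v set set \<Rightarrow> 'v set \<Rightarrow> bool" where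
  "independent_in F S \<longleftrightarrow> (\<forall>e\<in>F. \<not> e \<subseteq> S)"

text \<open>The value is meaningful only if some partition into independent sets exists; for finite \<open>V\<close>
  this is the case whenever all edges have at least two elements.\<close>

definition weak_chromatic_number :: "'v set \<Rightarrow> 'v set set \<Rightarrow> nat" where
  "weak_chromatic_number V F =
     (LEAST r. \<exists>P. partition_on V P \<and> finite P \<and> card P = r \<and> (\<forall>S\<in>P. independent_in F S))"

definition complete_edges :: "nat \<Rightarrow> nat \<Rightarrow> nat set set" where
  "complete_edges n k = nsets {..<n} k"

definition NC2 :: "nat \<Rightarrow> nat \<Rightarrow> nat set set set" where
  "NC2 n k = {F. F \<subseteq> complete_edges n k \<and> weak_chromatic_number {..<n} F > 2}"


section \<open>Waiter--Client games\<close>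

text \<open>A history lists the full rounds played so far, oldest first; the entry \<open>(A, c)\<close> records
  that Waiter offered \<open>A\<close> and Client claimed \<open>c\<close> (so Waiter claimed \<open>A - {c}\<close>).\<close>

type_synonym 'x history = "('x set \<times> 'x) list"

definition free_elements :: "'x set \<Rightarrow> 'x history \<Rightarrow> 'x set" where
  "free_elements X h = X - (\<Union>(A, c)\<in>set h. A)"

definition client_elements :: "'x history \<Rightarrow> 'x set" where
  "client_elements h = snd ` set h"

definition legal_offer :: "'x set \<Rightarrow> nat \<Rightarrow> 'x history \<Rightarrow> 'x set \<Rightarrow> bool" where
  "legal_offer X q h A \<longleftrightarrow> A \<subseteq> free_elements X h \<and> finite A \<and> card A = q + 1"

inductive legal_history :: "'x set \<Rightarrow> nat \<Rightarrow> 'x history \<Rightarrow> bool"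
  for X :: "'x set" and q :: nat where
  start: "legal_history X q []"
| play_round: "legal_history X q (h @ [(A, c)])"
    if "legal_history X q h" "legal_offer X q h A" "c \<in> A"

text \<open>Once fewer than \<open>q + 1\<close> elements are free, Waiter receives all of them, so Client's set
  is final.\<close>

definition finished :: "'x set \<Rightarrow> nat \<Rightarrow> 'x history \<Rightarrow> bool" where
  "finished X q h \<longleftrightarrow> legal_history X q h \<and> card (free_elements X h) < q + 1"

text \<open>Strategies may depend on the whole history.\<close>

definition waiter_strategy :: "'x set \<Rightarrow> nat \<Rightarrow> ('x history \<Rightarrow> 'x set) \<Rightarrow> bool" where
  "waiter_strategy X q \<sigma> \<longleftrightarrow>
     (\<forall>h. legal_history X q h \<and> \<not> finished X q h \<longrightarrow> legal_offer X q h (\<sigma> h))"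

definition client_strategy :: "'x set \<Rightarrow> nat \<Rightarrow> ('x history \<Rightarrow> 'x set \<Rightarrow> 'x) \<Rightarrow> bool" where
  "client_strategy X q \<tau> \<longleftrightarrow>
     (\<forall>h A. legal_history X q h \<and> legal_offer X q h A \<longrightarrow> \<tau> h A \<in> A)"

definition follows_waiter :: "('x history \<Rightarrow> 'x set) \<Rightarrow> 'x history \<Rightarrow> bool" where
  "follows_waiter \<sigma> h \<longleftrightarrow> (\<forall>i<length h. fst (h ! i) = \<sigma> (take i h))"

definition follows_client :: "('x history \<Rightarrow> 'x set \<Rightarrow> 'x) \<Rightarrow> 'x history \<Rightarrow> bool" where
  "follows_client \<tau> h \<longleftrightarrow> (\<forall>i<length h. snd (h ! i) = \<tau> (take i h) (fst (h ! i)))"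

definition client_has_winning_set :: "'x set set \<Rightarrow> 'x history \<Rightarrow> bool" where
  "client_has_winning_set \<F> h \<longleftrightarrow> (\<exists>W\<in>\<F>. W \<subseteq> client_elements h)"

definition waiter_wins :: "'x set \<Rightarrow> nat \<Rightarrow> 'x set set \<Rightarrow> bool" where
  "waiter_wins X q \<F> \<longleftrightarrow>
     (\<exists>\<sigma>. waiter_strategy X q \<sigma> \<and>
        (\<forall>h. finished X q h \<and> follows_waiter \<sigma> h \<longrightarrow> client_has_winning_set \<F> h))"

definition client_wins :: "'x set \<Rightarrow> nat \<Rightarrow> 'x set set \<Rightarrow> bool" where
  "client_wins X q \<F> \<longleftrightarrow>
     (\<exists>\<tau>. client_strategy X q \<tau> \<and>
        (\<forall>h. finished X q h \<and> follows_client \<tau> h \<longrightarrow> \<not> client_has_winning_set \<F> h))"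


section \<open>Claiming a winning set means building a non-2-colourable hypergraph\<close>

lemma weak_chromatic_number_mono:
  fixes V :: "'v set"
  assumes "finite V" "F \<subseteq> nsets V k" "k \<ge> 2" "W \<subseteq> F"
  shows "weak_chromatic_number V W \<le> weak_chromatic_number V F"
proof -
  let ?Q = "\<lambda>F r. \<exists>P. partition_on V P \<and> finite P \<and> card P = r \<and> (\<forall>S\<in>P. independent_in F S)"
  let ?P = "(\<lambda>v. {v}) ` V"
  have "partition_on V ?P"
    by (auto simp: partition_on_def disjoint_def)
  moreover have "independent_in F S" if S: "S \<in> ?P" for S
    unfolding independent_in_def
  proof (intro ballI notI)
    fix e assume "e \<in> F" "e \<subseteq> S"
    have "card e = k" using \<open>e \<in> F\<close> assms(2) by (auto simp: nsets_def)
    moreover have "finite S" "card S = 1" using S by auto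
    ultimately show False using card_mono[of S e] \<open>e \<subseteq> S\<close> assms(3) by simp
  qed
  ultimately have "?Q F (card ?P)" using assms(1) by blast
  then have "?Q F (weak_chromatic_number V F)"
    unfolding weak_chromatic_number_def by (rule LeastI)
  then obtain P where P: "partition_on V P" "finite P" "card P = weak_chromatic_number V F"
      "\<forall>S\<in>P. independent_in F S" by blast
  have "\<forall>S\<in>P. independent_in W S"
    using P(4) assms(4) unfolding independent_in_def by blast
  then have "?Q W (weak_chromatic_number V F)" using P(1-3) by blast
  then show ?thesis
    unfolding weak_chromatic_number_def[of V W] by (rule Least_le)
qed

lemma client_has_winning_set_NC2_iff:
  assumes "k \<ge> 2" "client_elements h \<subseteq> complete_edges n k"
  shows "client_has_winning_set (NC2 n k) h \<longleftrightarrow>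
           weak_chromatic_number {..<n} (client_elements h) > 2"
proof
  assume "client_has_winning_set (NC2 n k) h"
  then obtain W where W: "W \<subseteq> client_elements h" "weak_chromatic_number {..<n} W > 2"
    unfolding client_has_winning_set_def NC2_def by blast
  have "weak_chromatic_number {..<n} W \<le> weak_chromatic_number {..<n} (client_elements h)"
    by (rule weak_chromatic_number_mono[OF finite_lessThan _ assms(1) W(1)])
      (use assms(2) in \<open>simp add: complete_edges_def\<close>)
  then show "weak_chromatic_number {..<n} (client_elements h) > 2"
    using W(2) by (rule less_le_trans[rotated])
next
  assume "weak_chromatic_number {..<n} (client_elements h) > 2"
  then have "client_elements h \<in> NC2 n k"
    using assms(2) unfolding NC2_def by blast
  then show "client_has_winning_set (NC2 n k) h"
    unfolding client_has_winning_set_def by blast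
qed

end

theory Submission imports Defs "HOL-Analysis.Convex" begin

text \<open>Waiter makes Client claim an edge inside every vertex set of size \<open>\<lceil>n/2\<rceil>\<close>. She weighs each family
  of edges not yet hit by Client by \<open>r\<close> to the number of its free elements, where \<open>r ^ q = 2/3\<close>, and
  offers elements whose degrees (weights of the families containing them) agree up to a factor 2:
  then the weight removed by Client's element pays for the growth caused by the \<open>q\<close> others.

  Client avoids every \<open>s\<close> edges inside \<open>s\<close> vertices by derandomizing a uniformly random choice. If
  some set of edges spans at most as many vertices as it has edges, it contains such a
  configuration; otherwise Seymour's theorem makes the hypergraph 2-colourable.\<close>

section \<open>Histories\<close>

lemma free_elements_append:
  "free_elements X (h @ [(A, c)]) = free_elements X h - A"
  by (auto simp: free_elements_def)

lemma client_elements_append: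
  "client_elements (h @ [(A, c)]) = insert c (client_elements h)"
  by (auto simp: client_elements_def)

lemma client_elements_subset:
  "legal_history X q h \<Longrightarrow> client_elements h \<subseteq> X"
proof (induction rule: legal_history.induct)
  case start
  show ?case by (simp add: client_elements_def)
next
  case (play_round h A c)
  then show ?case
    by (auto simp: client_elements_append legal_offer_def free_elements_def)
qed

lemma follows_waiter_append:
  "follows_waiter \<sigma> (h @ [(A, c)]) \<longleftrightarrow> follows_waiter \<sigma> h \<and> A = \<sigma> h"
  by (auto simp: follows_waiter_def nth_append less_Suc_eq)

lemma follows_client_append:
  "follows_client \<tau> (h @ [(A, c)]) \<longleftrightarrow> follows_client \<tau> h \<and> c = \<tau> h A"
  by (auto simp: follows_client_def nth_append less_Suc_eq)

lemma finite_free_elements: "finite X \<Longrightarrow> finite (free_elements X h)"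
  by (simp add: free_elements_def)

section \<open>Waiter forcing a transversal\<close>

text \<open>The function j -> \<open>r ^ (-j)\<close> is convex, so on [0, q] it lies below the
  chord joining its values 1 at 0 and 3/2 at q. The value 2/3 gives this chord the slope 1/(2q),
  which is what degrees agreeing up to a factor 2 can pay for.\<close>

lemma power_le_chord:
  fixes r :: real
  assumes "0 < r" "r ^ q = 2 / 3" "q > 0" "j \<le> q"
  shows "1 \<le> r ^ j * (1 + real j / (2 * real q))"
proof -
  have b: "r = exp (ln r)" using assms(1) by simp
  let ?t = "real j / real q"
  have t: "0 \<le> ?t" "?t \<le> 1" using assms(3,4) by auto
  have q1: "exp (- (real q * ln r)) = 3 / 2"
  proof -
    have "exp (real q * ln r) = 2 / 3"
      using assms(1,2) by (metis b exp_of_nat_mult)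
    then show ?thesis by (simp only: exp_minus) simp
  qed
  have "exp ((1 - ?t) *\<^sub>R 0 + ?t *\<^sub>R (- (real q * ln r)))
      \<le> (1 - ?t) * exp 0 + ?t * exp (- (real q * ln r))"
    using t by (intro convex_onD[OF exp_convex]) auto
  also have "\<dots> = 1 + real j / (2 * real q)"
    unfolding q1 using assms(3) by (simp add: field_simps)
  also have "(1 - ?t) *\<^sub>R 0 + ?t *\<^sub>R (- (real q * ln r)) = - (real j * ln r)"
    using assms(3) by simp
  finally have "exp (- (real j * ln r)) \<le> 1 + real j / (2 * real q)" .
  moreover have "exp (real j * ln r) = r ^ j"
    using b by (metis exp_of_nat_mult)
  ultimately have "inverse (r ^ j) \<le> 1 + real j / (2 * real q)"
    by (simp add: exp_minus)
  then show ?thesis using assms(1) by (simp add: field_simps)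
qed

definition weight :: "real \<Rightarrow> 'x set \<Rightarrow> 'x set set \<Rightarrow> real" where
  "weight r S U = (\<Sum>A\<in>U. r ^ card (A \<inter> S))"

definition degree :: "real \<Rightarrow> 'x set \<Rightarrow> 'x set set \<Rightarrow> 'x \<Rightarrow> real" where
  "degree r S U v = weight r S {A \<in> U. v \<in> A}"

text \<open>Client's claim removes the sets containing c, of total weight
  \<open>degree r S U c\<close>. By the chord bound the other sets gain at most 1/(2q) times the sum
  of the degrees of the q elements of \<open>B - {c}\<close>, each at most twice the degree of c, so
  loss and gain balance.\<close>

lemma weight_offer_le:
  fixes r :: real
  assumes r: "0 < r" "r ^ q = 2 / 3" and q: "q > 0"
    and fin: "finite U" "finite S" and B: "B \<subseteq> S" "card B = q + 1"
    and ratio: "\<And>u v. u \<in> B \<Longrightarrow> v \<in> B \<Longrightarrow> degree r S U u \<le> 2 * degree r S U v"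
    and c: "c \<in> B"
  shows "weight r (S - B) {A \<in> U. c \<notin> A} \<le> weight r S U"
proof -
  let ?g = "\<lambda>A. r ^ card (A \<inter> S)" and ?Uc = "{A \<in> U. c \<notin> A}"
  have finO: "finite B" using B(2) by (simp add: card_ge_0_finite)
  have shrink: "r ^ card (A \<inter> (S - B)) \<le> ?g A * (1 + real (card (A \<inter> B)) / (2 * real q))"
    if "A \<in> ?Uc" for A
  proof -
    \<comment> \<open>A surviving set misses c, so it loses at most q elements and stays in the
      range of the chord bound.\<close>
    have "card (A \<inter> B) \<le> card (B - {c})"
      using that finO by (intro card_mono) auto
    then have le: "card (A \<inter> B) \<le> q" using B(2) c by simp
    have "A \<inter> S = (A \<inter> (S - B)) \<union> (A \<inter> B)" using B(1) by auto
    moreover have "card ((A \<inter> (S - B)) \<union> (A \<inter> B)) = card (A \<inter> (S - B)) + card (A \<inter> B)"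
      using fin finO by (intro card_Un_disjoint) auto
    ultimately have "?g A = r ^ card (A \<inter> (S - B)) * r ^ card (A \<inter> B)"
      by (simp add: power_add)
    then show ?thesis
      using mult_left_mono[OF power_le_chord[OF r q le], of "r ^ card (A \<inter> (S - B))"] r(1)
      by (simp add: mult.assoc)
  qed
  \<comment> \<open>Double counting of the pairs of a surviving set and an offered element in it
    turns the growth into a sum of degrees.\<close>
  have "(\<Sum>A\<in>?Uc. ?g A * real (card (A \<inter> B))) = (\<Sum>A\<in>?Uc. \<Sum>v\<in>B. if v \<in> A then ?g A else 0)"
    using finO by (intro sum.cong refl) (simp add: sum.If_cases Int_commute mult.commute)
  also have "\<dots> = (\<Sum>v\<in>B. \<Sum>A\<in>?Uc. if v \<in> A then ?g A else 0)"
    by (rule sum.swap)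
  also have "\<dots> = (\<Sum>v\<in>B - {c}. \<Sum>A\<in>?Uc. if v \<in> A then ?g A else 0)"
    using finO by (intro sum.mono_neutral_right) auto
  also have "\<dots> \<le> (\<Sum>v\<in>B - {c}. 2 * degree r S U c)"
  proof (rule sum_mono)
    fix v assume v: "v \<in> B - {c}"
    have "(\<Sum>A\<in>?Uc. if v \<in> A then ?g A else 0) = (\<Sum>A\<in>{A \<in> ?Uc. v \<in> A}. ?g A)"
      using fin by (intro sum.inter_filter[symmetric]) auto
    also have "\<dots> \<le> degree r S U v"
      unfolding degree_def weight_def using fin r by (intro sum_mono2) auto
    also have "\<dots> \<le> 2 * degree r S U c" using ratio v c by auto
    finally show "(\<Sum>A\<in>?Uc. if v \<in> A then ?g A else 0) \<le> 2 * degree r S U c" .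
  qed
  also have "\<dots> = 2 * real q * degree r S U c" using B(2) c by simp
  finally have double: "(\<Sum>A\<in>?Uc. ?g A * real (card (A \<inter> B))) \<le> 2 * real q * degree r S U c" .
  have "weight r (S - B) ?Uc \<le> (\<Sum>A\<in>?Uc. ?g A * (1 + real (card (A \<inter> B)) / (2 * real q)))"
    unfolding weight_def using shrink by (intro sum_mono)
  also have "\<dots> = (\<Sum>A\<in>?Uc. ?g A) + (\<Sum>A\<in>?Uc. ?g A * real (card (A \<inter> B))) / (2 * real q)"
    by (simp add: distrib_left sum.distrib sum_divide_distrib)
  also have "\<dots> \<le> (\<Sum>A\<in>?Uc. ?g A) + degree r S U c"
    using double q by (simp add: field_simps)
  also have "\<dots> = weight r S U"
  proof -
    have "U = ?Uc \<union> {A \<in> U. c \<in> A}" by auto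
    then have "weight r S U = (\<Sum>A\<in>?Uc \<union> {A \<in> U. c \<in> A}. ?g A)"
      unfolding weight_def by simp
    also have "\<dots> = (\<Sum>A\<in>?Uc. ?g A) + degree r S U c"
      unfolding degree_def weight_def using fin by (intro sum.union_disjoint) auto
    finally show ?thesis by simp
  qed
  finally show ?thesis .
qed

text \<open>The degrees of the free elements of a surviving set \<open>A\<close> lie between \<open>r ^ card (A \<inter> S)\<close> and the
  total weight. If every dyadic interval of degrees held at most \<open>q\<close> of them, \<open>card (A \<inter> S)\<close>
  would be too small for the total weight to be below 1/2.\<close>

lemma exists_balanced_offer:
  fixes r :: real
  assumes r: "0 < r" "r ^ q = 2 / 3" and q: "q > 0"
    and fin: "finite U" "finite S" and A: "A \<in> U" and small: "weight r S U < 1 / 2"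
  shows "\<exists>B. B \<subseteq> S \<and> card B = q + 1 \<and>
    (\<forall>u\<in>B. \<forall>v\<in>B. degree r S U u \<le> 2 * degree r S U v)"
proof -
  let ?N = "card (A \<inter> S)" and ?d = "degree r S U" and ?W = "weight r S U"
  define g where "g = r ^ ?N"
  have g: "g > 0" using r by (simp add: g_def)
  have r1: "r \<le> 1"
  proof (rule ccontr)
    assume "\<not> r \<le> 1"
    then have "1 \<le> r ^ q" by (intro one_le_power) simp
    then show False using r(2) by simp
  qed
  have lo: "g \<le> ?d v" if "v \<in> A" for v
    unfolding g_def degree_def weight_def
    using that fin A r by (intro member_le_sum[of A _ "\<lambda>A. r ^ card (A \<inter> S)"]) auto
  have hi: "?d v \<le> ?W" for v
    unfolding degree_def weight_def using fin r by (intro sum_mono2) auto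
  have gW: "g \<le> ?W"
    unfolding g_def weight_def
    using fin A r by (intro member_le_sum[of A _ "\<lambda>A. r ^ card (A \<inter> S)"]) auto
  \<comment> \<open>Dyadic scale with unit g, a lower bound for the degrees on A. For x \<ge> g the
    logarithm is nonnegative, so \<open>nat\<close> does not truncate.\<close>
  define \<kappa> where "\<kappa> = (\<lambda>x. nat \<lfloor>log 2 (x / g)\<rfloor>)"
  have \<kappa>: "2 ^ \<kappa> x * g \<le> x" "x < 2 * (2 ^ \<kappa> x * g)" if "g \<le> x" for x
  proof -
    have x: "x > 0" "1 \<le> x / g" using that g by (auto simp: field_simps)
    then have nn: "0 \<le> log 2 (x / g)" by simp
    then have "real (\<kappa> x) \<le> log 2 (x / g)" "log 2 (x / g) < real (\<kappa> x) + 1"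
      unfolding \<kappa>_def by linarith+
    then have "2 powr real (\<kappa> x) \<le> x / g" "x / g < 2 powr (real (\<kappa> x) + 1)"
      using x g by (auto simp: le_log_iff log_less_iff)
    then show "2 ^ \<kappa> x * g \<le> x" "x < 2 * (2 ^ \<kappa> x * g)"
      using g by (auto simp: powr_add powr_realpow field_simps)
  qed
  define M where "M = \<kappa> ?W"
  define fibre where "fibre = (\<lambda>i. {v \<in> A \<inter> S. \<kappa> (?d v) = i})"
  have "\<exists>i. card (fibre i) \<ge> q + 1"
  proof (rule ccontr)
    assume "\<not> ?thesis"
    then have small_fibre: "card (fibre i) \<le> q" for i
      by (metis Suc_eq_plus1 not_less_eq_eq)
    have "A \<inter> S \<subseteq> (\<Union>i\<in>{..M}. fibre i)"
    proof
      fix v assume v: "v \<in> A \<inter> S"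
      have "?d v / g \<le> ?W / g" "0 < ?d v / g" 
        using hi[of v] lo[of v] g v by (auto simp: field_simps)
      then have "\<kappa> (?d v) \<le> M"
        unfolding M_def \<kappa>_def by (intro nat_mono floor_mono) simp
      then show "v \<in> (\<Union>i\<in>{..M}. fibre i)" using v by (auto simp: fibre_def)
    qed
    then have "?N \<le> card (\<Union>i\<in>{..M}. fibre i)"
      using fin by (intro card_mono) (auto simp: fibre_def)
    also have "\<dots> \<le> (\<Sum>i\<in>{..M}. card (fibre i))" by (intro card_UN_le) simp
    also have "\<dots> \<le> (\<Sum>i\<in>{..M}. q)" using small_fibre by (intro sum_mono)
    \<comment> \<open>Hence g is at least (2/3)^(M+1), so at least (1/2)^(M+1); as M is the index of
      the total weight, that weight is at least 2^M * g \<ge> 1/2.\<close>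
    finally have "?N \<le> q * (M + 1)" by (simp add: mult.commute)
    then have "r ^ (q * (M + 1)) \<le> g"
      unfolding g_def using r r1 by (intro power_decreasing) auto
    then have "(2 / 3) ^ (M + 1) \<le> g" by (metis power_mult r(2))
    moreover have "(1 / 2 :: real) ^ (M + 1) \<le> (2 / 3) ^ (M + 1)" by (intro power_mono) auto
    ultimately have "(1 / 2) ^ (M + 1) \<le> g" by linarith
    then have "2 ^ M * (1 / 2) ^ (M + 1) \<le> 2 ^ M * g" by (intro mult_left_mono) auto
    then have "1 / 2 \<le> 2 ^ M * g" by (simp add: power_divide)
    also have "\<dots> \<le> ?W" unfolding M_def using \<kappa>[OF gW] by simp
    finally show False using small by simp
  qed
  then obtain i where "card (fibre i) \<ge> q + 1" by blast
  then obtain B where B: "B \<subseteq> fibre i" "card B = q + 1"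
    using obtain_subset_with_card_n by metis
  have "?d u \<le> 2 * ?d v" if "u \<in> B" "v \<in> B" for u v
  proof -
    have uv: "u \<in> A" "v \<in> A" "\<kappa> (?d u) = i" "\<kappa> (?d v) = i"
      using that B by (auto simp: fibre_def)
    then have "?d u < 2 * (2 ^ i * g)" "2 ^ i * g \<le> ?d v"
      using \<kappa>[OF lo] by metis+
    then show ?thesis by linarith
  qed
  then show ?thesis using B by (auto simp: fibre_def)
qed

definition unhit :: "'x set set \<Rightarrow> 'x history \<Rightarrow> 'x set set" where
  "unhit \<A> h = {A \<in> \<A>. A \<inter> client_elements h = {}}"

text \<open>The weight of the unhit sets starts below 1/2 and balanced offers keep it there. Below
  1/2, an unhit set guarantees another balanced offer, so play cannot end while one is left.\<close>

lemma waiter_forces_transversal: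
  fixes r :: real
  assumes r: "0 < r" "r ^ q = 2 / 3" and q: "q > 0"
    and fin: "finite X" "finite \<A>" and sub: "\<And>A. A \<in> \<A> \<Longrightarrow> A \<subseteq> X"
    and small: "(\<Sum>A\<in>\<A>. r ^ card A) < 1 / 2"
  shows "\<exists>\<sigma>. waiter_strategy X q \<sigma> \<and>
    (\<forall>h. finished X q h \<and> follows_waiter \<sigma> h \<longrightarrow> (\<forall>A\<in>\<A>. A \<inter> client_elements h \<noteq> {}))"
proof -
  define \<Phi> where "\<Phi> = (\<lambda>h. weight r (free_elements X h) (unhit \<A> h))"
  \<comment> \<open>A strategy must make legal offers at every unfinished legal history, also where
    the potential is not below 1/2; only legality is asked there.\<close>
  define good where "good = (\<lambda>h B. legal_offer X q h B \<and>
      (\<Phi> h < 1 / 2 \<longrightarrow> (\<forall>c\<in>B. \<Phi> (h @ [(B, c)]) \<le> \<Phi> h)))"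
  have unhit_append: "unhit \<A> (h @ [(B, c)]) = {A \<in> unhit \<A> h. c \<notin> A}" for h :: "'a history" and B c
    by (auto simp: unhit_def client_elements_append)
  have fin_unhit: "finite (unhit \<A> h)" for h using fin by (simp add: unhit_def)
  have offer: "\<exists>B. legal_offer X q h B \<and> (\<forall>c\<in>B. \<Phi> (h @ [(B, c)]) \<le> \<Phi> h)"
    if "\<Phi> h < 1 / 2" "unhit \<A> h \<noteq> {}" for h
  proof -
    have S: "finite (free_elements X h)" using fin by (simp add: finite_free_elements)
    from that(2) obtain A where "A \<in> unhit \<A> h" by blast
    from exists_balanced_offer[OF r q fin_unhit S this] that(1)
    obtain B where B: "B \<subseteq> free_elements X h" "card B = q + 1"
      "\<forall>u\<in>B. \<forall>v\<in>B. degree r (free_elements X h) (unhit \<A> h) u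
          \<le> 2 * degree r (free_elements X h) (unhit \<A> h) v"
      unfolding \<Phi>_def by blast
    then have "legal_offer X q h B"
      using S by (auto simp: legal_offer_def intro: finite_subset)
    moreover have "\<Phi> (h @ [(B, c)]) \<le> \<Phi> h" if "c \<in> B" for c
      unfolding \<Phi>_def free_elements_append unhit_append
      by (rule weight_offer_le[OF r q fin_unhit S B(1,2) _ that]) (use B(3) in blast)
    ultimately show ?thesis by blast
  qed
  have ex: "\<exists>B. good h B" if "legal_history X q h" "\<not> finished X q h" for h
  proof (cases "\<Phi> h < 1 / 2 \<and> unhit \<A> h \<noteq> {}")
    case True
    then show ?thesis using offer unfolding good_def by blast
  next
    \<comment> \<open>Either no bound is demanded, or no set is unhit and the potential is 0 before
      and after: any legal offer serves.\<close>
    case False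
    have "card (free_elements X h) \<ge> q + 1" using that by (auto simp: finished_def)
    then obtain B where B: "B \<subseteq> free_elements X h" "card B = q + 1"
      using obtain_subset_with_card_n by metis
    then have "legal_offer X q h B"
      using fin by (auto simp: legal_offer_def finite_free_elements intro: finite_subset)
    moreover have "\<Phi> (h @ [(B, c)]) \<le> \<Phi> h" if "\<Phi> h < 1 / 2" for c
      using False that by (simp add: \<Phi>_def unhit_append weight_def)
    ultimately show ?thesis unfolding good_def by blast
  qed
  define \<sigma> where "\<sigma> = (\<lambda>h. SOME B. good h B)"
  have \<sigma>: "good h (\<sigma> h)" if "legal_history X q h" "\<not> finished X q h" for h
    unfolding \<sigma>_def using ex[OF that] by (rule someI_ex)
  have inv: "\<Phi> h < 1 / 2" if "legal_history X q h" "follows_waiter \<sigma> h" for h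
    using that
  proof (induction rule: legal_history.induct)
    case start
    have "unhit \<A> [] = \<A>" "free_elements X [] = X"
      by (simp_all add: unhit_def client_elements_def free_elements_def)
    moreover have "A \<inter> X = A" if "A \<in> \<A>" for A using sub[OF that] by blast
    ultimately show ?case using small by (simp add: \<Phi>_def weight_def)
  next
    case (play_round h A c)
    have "card A \<le> card (free_elements X h)"
      using play_round fin by (intro card_mono) (auto simp: legal_offer_def finite_free_elements)
    then have "\<not> finished X q h" using play_round by (auto simp: legal_offer_def finished_def)
    then show ?case
      using \<sigma>[of h] play_round by (auto simp: follows_waiter_append good_def intro: le_less_trans)
  qed
  have "unhit \<A> h = {}" if "finished X q h" "follows_waiter \<sigma> h" for h
  proof (rule ccontr)
    assume "unhit \<A> h \<noteq> {}"
    moreover have "\<Phi> h < 1 / 2" using inv that by (auto simp: finished_def)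
    ultimately obtain B where "legal_offer X q h B" using offer by blast
    then have "q + 1 \<le> card (free_elements X h)"
      using fin by (metis card_mono finite_free_elements legal_offer_def)
    then show False using that by (auto simp: finished_def)
  qed
  then show ?thesis
    using \<sigma> by (intro exI[of _ \<sigma>]) (auto simp: waiter_strategy_def good_def unhit_def)
qed

section \<open>Client avoiding small winning sets\<close>

text \<open>For a uniformly random choice of Client, a set meeting the offer in one element survives with
  probability \<open>1 / (q + 1)\<close> and its term grows by the factor \<open>q + 1\<close>, so the expected danger
  does not increase.\<close>

definition danger :: "nat \<Rightarrow> 'x set \<Rightarrow> 'x set \<Rightarrow> 'x set set \<Rightarrow> real" where
  "danger q S C \<W> = (\<Sum>W | W \<in> \<W> \<and> W \<subseteq> C \<union> S. (1 / real (q + 1)) ^ card (W - C))"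

text \<open>Averaging over the q + 1 possible claims: the danger after a claim, summed over all
  claims, is at most q + 1 times the present danger. This is checked for each winning set
  separately.\<close>

lemma exists_safe_choice:
  assumes fin: "finite \<W>" "finite S" "finite C" and disj: "S \<inter> C = {}"
    and B: "B \<subseteq> S" "card B = q + 1"
  shows "\<exists>c\<in>B. danger q (S - B) (insert c C) \<W> \<le> danger q S C \<W>"
proof (rule ccontr)
  assume neg: "\<not> ?thesis"
  let ?p = "1 / real (q + 1)"
  let ?f = "\<lambda>W c. if W \<subseteq> insert c C \<union> (S - B) then ?p ^ card (W - insert c C) else 0"
  let ?g = "\<lambda>W. if W \<subseteq> C \<union> S then ?p ^ card (W - C) else 0"
  have finB: "finite B" using B(2) by (simp add: card_ge_0_finite)
  have *: "(\<Sum>c\<in>B. ?f W c) \<le> real (q + 1) * ?g W" for W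
  \<comment> \<open>In the first case W survives for the claim v alone, and its term then grows by
    the factor q + 1. Otherwise W either avoids the offer and keeps its term, or is lost whatever
    Client claims.\<close>
  proof (cases "\<exists>v\<in>B. v \<in> W \<and> W \<subseteq> insert v C \<union> (S - B)")
    case True
    then obtain v where v: "v \<in> B" "v \<in> W" "W \<subseteq> insert v C \<union> (S - B)" by blast
    have "(\<Sum>c\<in>B. ?f W c) = (\<Sum>c\<in>{v}. ?f W c)"
      using v finB disj B(1) by (intro sum.mono_neutral_right) auto
    also have "\<dots> = ?p ^ card (W - insert v C)" using v by simp
    also have "\<dots> = real (q + 1) * ?p ^ card (W - C)"
    proof -
      have "v \<notin> C" using v disj B(1) by auto
      moreover have "finite (W - C)"
        using v(3) fin by (meson finite_Diff finite_UnI finite_insert finite_subset)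
      moreover have "W - C = insert v (W - insert v C)" using v \<open>v \<notin> C\<close> by auto
      ultimately have "card (W - C) = Suc (card (W - insert v C))"
        by (metis Diff_iff card_insert_disjoint finite_insert insertI1)
      then show ?thesis by simp
    qed
    also have "W \<subseteq> C \<union> S" using v B(1) by auto
    then have "?p ^ card (W - C) = ?g W" by simp
    finally show ?thesis by (rule eq_refl)
  next
    case False
    have "?f W c \<le> ?g W" if "c \<in> B" for c
    proof (cases "W \<subseteq> insert c C \<union> (S - B)")
      case True
      then have "c \<notin> W" using False that by blast
      then have "W - insert c C = W - C" "W \<subseteq> C \<union> S" using True by auto
      then show ?thesis by simp
    qed simp
    then have "(\<Sum>c\<in>B. ?f W c) \<le> (\<Sum>c\<in>B. ?g W)" by (rule sum_mono)
    then show ?thesis using B(2) by simp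
  qed
  have "real (q + 1) * danger q S C \<W> = (\<Sum>c\<in>B. danger q S C \<W>)" using B(2) by simp
  also have "\<dots> < (\<Sum>c\<in>B. danger q (S - B) (insert c C) \<W>)"
    using neg finB B(2) by (intro sum_strict_mono) auto
  also have "\<dots> = (\<Sum>c\<in>B. \<Sum>W\<in>\<W>. ?f W c)"
    unfolding danger_def using fin(1) by (intro sum.cong refl sum.inter_filter)
  also have "\<dots> = (\<Sum>W\<in>\<W>. \<Sum>c\<in>B. ?f W c)" by (rule sum.swap)
  also have "\<dots> \<le> (\<Sum>W\<in>\<W>. real (q + 1) * ?g W)" using * by (intro sum_mono)
  also have "\<dots> = real (q + 1) * (\<Sum>W\<in>\<W>. ?g W)" by (rule sum_distrib_left[symmetric])
  also have "(\<Sum>W\<in>\<W>. ?g W) = danger q S C \<W>"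
    unfolding danger_def using fin(1) by (intro sum.inter_filter[symmetric])
  finally show False by simp
qed

lemma free_client_disjoint:
  "legal_history X q h \<Longrightarrow> free_elements X h \<inter> client_elements h = {}"
proof (induction rule: legal_history.induct)
  case start
  show ?case by (simp add: client_elements_def)
next
  case (play_round h A c)
  then show ?case by (auto simp: client_elements_append free_elements_append)
qed

text \<open>Client never lets the danger increase, so it stays below 1, whereas a fully claimed
  winning set alone would contribute 1.\<close>

lemma client_avoids_sets:
  assumes fin: "finite X" "finite \<W>" and sub: "\<And>W. W \<in> \<W> \<Longrightarrow> W \<subseteq> X"
    and small: "(\<Sum>W\<in>\<W>. (1 / real (q + 1)) ^ card W) < 1"
  shows "\<exists>\<tau>. client_strategy X q \<tau> \<and>
    (\<forall>h. finished X q h \<and> follows_client \<tau> h \<longrightarrow> (\<forall>W\<in>\<W>. \<not> W \<subseteq> client_elements h))"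
proof -
  define \<Phi> where "\<Phi> = (\<lambda>h. danger q (free_elements X h) (client_elements h) \<W>)"
  define \<tau> where "\<tau> = (\<lambda>h A. SOME c. c \<in> A \<and> \<Phi> (h @ [(A, c)]) \<le> \<Phi> h)"
  have \<tau>: "\<tau> h A \<in> A \<and> \<Phi> (h @ [(A, \<tau> h A)]) \<le> \<Phi> h"
    if "legal_history X q h" "legal_offer X q h A" for h A
  proof -
    have "finite (free_elements X h)" "finite (client_elements h)"
      using fin(1) by (auto simp: finite_free_elements client_elements_def)
    from exists_safe_choice[OF fin(2) this free_client_disjoint[OF that(1)], of A q]
    have "\<exists>c. c \<in> A \<and> \<Phi> (h @ [(A, c)]) \<le> \<Phi> h"
      using that(2) by (auto simp: legal_offer_def \<Phi>_def free_elements_append client_elements_append)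
    then show ?thesis unfolding \<tau>_def by (rule someI_ex)
  qed
  have inv: "\<Phi> h < 1" if "legal_history X q h" "follows_client \<tau> h" for h
    using that
  proof (induction rule: legal_history.induct)
    case start
    have "{W \<in> \<W>. W \<subseteq> X} = \<W>" using sub by blast
    then show ?case
      using small by (simp add: \<Phi>_def danger_def client_elements_def free_elements_def)
  next
    case (play_round h A c)
    then show ?case using \<tau>[of h A] by (auto simp: follows_client_append)
  qed
  have "\<not> W \<subseteq> client_elements h"
    if h: "legal_history X q h" "follows_client \<tau> h" and W: "W \<in> \<W>" for h W
  proof
    let ?C = "client_elements h" and ?S = "free_elements X h"
    assume "W \<subseteq> ?C"
    then have "(1 / real (q + 1)) ^ card (W - ?C) \<le> \<Phi> h"
      unfolding \<Phi>_def danger_def using W fin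
      by (intro member_le_sum[of W _ "\<lambda>W. (1 / real (q + 1)) ^ card (W - ?C)"]) auto
    moreover have "W - ?C = {}" using \<open>W \<subseteq> ?C\<close> by blast
    ultimately show False using inv[OF h] by simp
  qed
  then show ?thesis
    using \<tau> by (intro exI[of _ \<tau>]) (auto simp: client_strategy_def finished_def)
qed

section \<open>Two-colourings\<close>

text \<open>Gaussian elimination, by induction on the number of equations: a pivot p of one equation
  is eliminated from the others, and its value is recovered by back substitution.\<close>

lemma underdetermined_system:
  fixes a :: "'i \<Rightarrow> 'v \<Rightarrow> real"
  assumes "finite I" "finite V" "card I < card V"
  shows "\<exists>x. (\<exists>v\<in>V. x v \<noteq> 0) \<and> (\<forall>i\<in>I. (\<Sum>v\<in>V. a i v * x v) = 0)"
  using assms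
proof (induction I arbitrary: V a rule: finite_induct)
  case empty
  then show ?case by (intro exI[of _ "\<lambda>_. 1"]) (auto simp: card_gt_0_iff)
next
  case (insert i I)
  show ?case
  proof (cases "\<forall>v\<in>V. a i v = 0")
    case True
    have "card I < card V" using insert by simp
    from insert.IH[OF insert.prems(1) this, of a] True show ?thesis by auto
  next
    case False
    then obtain p where p: "p \<in> V" "a i p \<noteq> 0" by blast
    let ?V = "V - {p}"
    have "card I < card ?V" using insert p by simp
    with insert.IH[of ?V "\<lambda>j v. a j v - a j p * a i v / a i p"] insert.prems(1)
    obtain x where x: "\<exists>v\<in>?V. x v \<noteq> 0"
      "\<And>j. j \<in> I \<Longrightarrow> (\<Sum>v\<in>?V. (a j v - a j p * a i v / a i p) * x v) = 0"
      by auto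
    \<comment> \<open>The value at p is chosen to solve equation i; the eliminated coefficients then
      make the other equations hold as well.\<close>
    define y where "y = x(p := - (\<Sum>v\<in>?V. a i v * x v) / a i p)"
    have y: "(\<Sum>v\<in>V. a j v * y v) = (\<Sum>v\<in>?V. (a j v - a j p * a i v / a i p) * x v)" for j
    proof -
      have "(\<Sum>v\<in>V. a j v * y v) = a j p * y p + (\<Sum>v\<in>?V. a j v * y v)"
        using insert.prems(1) p(1) by (rule sum.remove)
      also have "(\<Sum>v\<in>?V. a j v * y v) = (\<Sum>v\<in>?V. a j v * x v)"
        by (intro sum.cong) (auto simp: y_def)
      also have "a j p * y p = - (\<Sum>v\<in>?V. a j p * a i v / a i p * x v)"
        by (simp add: y_def sum_distrib_left sum_divide_distrib mult.assoc)
      finally show ?thesis by (simp add: left_diff_distrib sum_subtractf)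
    qed
    have "(\<Sum>v\<in>V. a i v * y v) = 0" unfolding y using p(2) by simp
    moreover have "(\<Sum>v\<in>V. a j v * y v) = 0" if "j \<in> I" for j unfolding y using x(2) that .
    moreover have "\<exists>v\<in>V. y v \<noteq> 0" using x(1) by (auto simp: y_def)
    ultimately show ?thesis by (intro exI[of _ y]) auto
  qed
qed

text \<open>Seymour's argument: with fewer edges than vertices, some nonzero vector sums to zero on every
  edge. Its sign colours every edge meeting its support; the other edges are coloured by
  induction.\<close>

lemma two_colouring_if_expanding:
  assumes "finite F" "\<And>e. e \<in> F \<Longrightarrow> finite e"
    and "\<And>F'. F' \<subseteq> F \<Longrightarrow> F' \<noteq> {} \<Longrightarrow> card F' < card (\<Union>F')"
  shows "\<exists>R. \<forall>e\<in>F. \<not> e \<subseteq> R \<and> e \<inter> R \<noteq> {}"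
  using assms
proof (induction F rule: finite_psubset_induct)
  case (psubset F)
  show ?case
  proof (cases "F = {}")
    case False
    let ?V = "\<Union>F"
    have finV: "finite ?V" using psubset by blast
    have "card F < card ?V" using psubset.prems(2)[of F] False by simp
    from underdetermined_system[OF psubset.hyps finV this, of "\<lambda>e v. of_bool (v \<in> e)"]
    obtain x :: "'a \<Rightarrow> real" where x: "\<exists>v\<in>?V. x v \<noteq> 0"
      and "\<And>e. e \<in> F \<Longrightarrow> (\<Sum>v\<in>?V. of_bool (v \<in> e) * x v) = 0" by blast
    moreover have "(\<Sum>v\<in>?V. of_bool (v \<in> e) * x v) = (\<Sum>v\<in>e. x v)" if "e \<in> F" for e
      using that finV by (intro sum.mono_neutral_cong_right) auto
    ultimately have sum0: "(\<Sum>v\<in>e. x v) = 0" if "e \<in> F" for e using that by simp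
    let ?Z = "{v. x v = 0}"
    \<comment> \<open>The edges that the sign leaves undecided. They form a proper subfamily, since
      some vertex of the support lies in an edge.\<close>
    let ?FZ = "{e \<in> F. e \<subseteq> ?Z}"
    have "?FZ \<subset> F" using x by blast
    from psubset.IH[OF this] psubset.prems
    obtain R where R: "\<And>e. e \<in> ?FZ \<Longrightarrow> \<not> e \<subseteq> R \<and> e \<inter> R \<noteq> {}"
      by (smt (verit, best) mem_Collect_eq subset_iff)
    let ?R = "{v. x v > 0} \<union> (R \<inter> ?Z)"
    have "\<not> e \<subseteq> ?R \<and> e \<inter> ?R \<noteq> {}" if e: "e \<in> F" for e
    proof (cases "e \<subseteq> ?Z")
      case True
      then show ?thesis using R[of e] e by fastforce
    next
      case False
      \<comment> \<open>An edge meeting the support has sum zero, so it contains a positive vertex,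
        which is in the colour class, and a negative one, which is not.\<close>
      have fe: "finite e" using psubset.prems(1) e .
      have "\<not> (\<forall>v\<in>e. x v \<ge> 0)"
        using sum_nonneg_eq_0_iff[of e x] fe sum0[OF e] False by auto
      moreover have "\<not> (\<forall>v\<in>e. x v \<le> 0)"
        using sum_nonneg_eq_0_iff[of e "\<lambda>v. - x v"] fe sum0[OF e] False
        by (auto simp: sum_negf)
      ultimately show ?thesis by force
    qed
    then show ?thesis by blast
  qed auto
qed

lemma weak_chromatic_number_le_2:
  assumes "finite V" and F: "F \<subseteq> nsets V k"
    and R: "\<And>e. e \<in> F \<Longrightarrow> \<not> e \<subseteq> R \<and> e \<inter> R \<noteq> {}"
  shows "weak_chromatic_number V F \<le> 2"
proof -
  \<comment> \<open>The blocks of a partition must be nonempty, so an empty colour class is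
    dropped.\<close>
  let ?P = "{V \<inter> R, V - R} - {{}}"
  have "partition_on V ?P" by (auto simp: partition_on_def disjoint_def)
  moreover have "\<forall>S\<in>?P. independent_in F S"
    using R by (auto simp: independent_in_def)
  moreover have "finite ?P" by simp
  ultimately have "weak_chromatic_number V F \<le> card ?P"
    unfolding weak_chromatic_number_def by (intro Least_le) blast
  also have "\<dots> \<le> card {V \<inter> R, V - R}" by (intro card_mono) auto
  also have "\<dots> \<le> 2" by (simp add: card_insert_if)
  finally show ?thesis .
qed

text \<open>One of at most two colour classes holds at least half of the vertices. This is why
  hitting all vertex sets of half size is enough for Waiter.\<close>

lemma large_independent_set:
  fixes V :: "'v set"
  assumes V: "finite V" "V \<noteq> {}" and F: "F \<subseteq> nsets V k" "k \<ge> 2"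
    and chi: "weak_chromatic_number V F \<le> 2"
  shows "\<exists>S\<subseteq>V. card V \<le> 2 * card S \<and> independent_in F S"
proof -
  let ?Q = "\<lambda>r. \<exists>P. partition_on V P \<and> finite P \<and> card P = r \<and> (\<forall>S\<in>P. independent_in F S)"
  \<comment> \<open>The singletons form a partition into independent sets because edges have at
    least two vertices; so the minimum in the chromatic number is attained.\<close>
  let ?P = "(\<lambda>v. {v}) ` V"
  have "independent_in F {v}" for v
    unfolding independent_in_def
  proof (intro ballI notI)
    fix e assume "e \<in> F" "e \<subseteq> {v}"
    then have "card e = k" "card e \<le> 1"
      using F(1) card_mono[of "{v}" e] by (auto simp: nsets_def)
    then show False using F(2) by simp
  qed
  moreover have "partition_on V ?P" by (auto simp: partition_on_def disjoint_def)
  ultimately have "?Q (card ?P)" using V(1) by blast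
  then have "?Q (weak_chromatic_number V F)"
    unfolding weak_chromatic_number_def by (rule LeastI)
  then obtain P where P: "partition_on V P" "finite P" "card P \<le> 2" "\<forall>S\<in>P. independent_in F S"
    using chi by auto
  have U: "\<Union>P = V" using P(1) by (simp add: partition_on_def)
  have "\<exists>S\<in>P. card V \<le> 2 * card S"
  proof (rule ccontr)
    assume neg: "\<not> ?thesis"
    have "card V \<le> (\<Sum>S\<in>P. card S)"
      unfolding U[symmetric] by (rule card_Union_le_sum_card)
    then have "2 * card V \<le> (\<Sum>S\<in>P. 2 * card S)" by (simp flip: sum_distrib_left)
    also have "\<dots> < (\<Sum>S\<in>P. card V)"
      using neg P(2) V(2) U by (intro sum_strict_mono) auto
    also have "\<dots> \<le> 2 * card V" using P(3) by simp
    finally show False by simp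
  qed
  then show ?thesis using P(4) U by blast
qed

section \<open>Thresholds\<close>

text \<open>The transversal result is applied to the complete k-uniform hypergraphs on all m-subsets
  of the vertices. The condition on m says that m is at most n/2 rounded up.\<close>

lemma waiter_wins_NC2:
  assumes k: "k \<ge> 2" and n: "n \<ge> 1" and q: "q > 0"
    and m: "\<And>s. n \<le> 2 * s \<Longrightarrow> m \<le> s" and qm: "q * (2 * n + 2) \<le> m choose k"
  shows "waiter_wins (complete_edges n k) q (NC2 n k)"
proof -
  define r :: real where "r = (2 / 3) powr (1 / real q)"
  have r: "0 < r" "r ^ q = 2 / 3"
    using q by (auto simp: r_def powr_powr simp flip: powr_realpow)
  have r1: "r \<le> 1" unfolding r_def by (intro powr_le1) auto
  define \<A> where "\<A> = (\<lambda>T. nsets T k) ` nsets {..<n} m"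
  have finX: "finite (complete_edges n k)" by (simp add: complete_edges_def finite_imp_finite_nsets)
  have fin: "finite (nsets {..<n} m)" by (simp add: finite_imp_finite_nsets)
  \<comment> \<open>Only an inequality, as different vertex sets may span the same edge set, for
    instance the empty one when m < k.\<close>
  have "(\<Sum>A\<in>\<A>. r ^ card A) \<le> (\<Sum>T\<in>nsets {..<n} m. r ^ card (nsets T k))"
    unfolding \<A>_def using fin r by (intro order_trans[OF sum_image_le]) auto
  also have "\<dots> = (\<Sum>T\<in>nsets {..<n} m. r ^ (m choose k))"
    by (intro sum.cong) (auto simp: nsets_def[of "{..<n}"])
  also have "\<dots> = real (n choose m) * r ^ (m choose k)" by simp
  also have "\<dots> \<le> 2 ^ n * r ^ (q * (2 * n + 2))"
  proof (intro mult_mono)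
    show "real (n choose m) \<le> 2 ^ n"
      using binomial_le_pow2[of n m] by (metis of_nat_le_iff of_nat_numeral of_nat_power)
    show "r ^ (m choose k) \<le> r ^ (q * (2 * n + 2))"
      using r r1 qm by (intro power_decreasing) auto
  qed (use r in auto)
  also have "\<dots> = 2 ^ n * (4 / 9) ^ (n + 1)"
  \<comment> \<open>The factor 2n + 2 is chosen so that (2/3)^(2n+2) = (4/9)^(n+1), which beats the
    at most 2^n vertex sets because 4/9 < 1/2.\<close>
  proof -
    have "r ^ (q * (2 * n + 2)) = ((2 / 3) ^ 2) ^ (n + 1)"
      unfolding power_mult[of r q] r(2) power_mult[symmetric] by (simp add: algebra_simps)
    then show ?thesis by (simp add: power2_eq_square)
  qed
  also have "\<dots> < 2 ^ n * (1 / 2) ^ (n + 1)"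
    by (intro mult_strict_left_mono power_strict_mono) auto
  also have "\<dots> = 1 / 2" by (simp add: power_divide)
  finally have small: "(\<Sum>A\<in>\<A>. r ^ card A) < 1 / 2" .
  have "finite \<A>" using fin by (simp add: \<A>_def)
  moreover have "A \<subseteq> complete_edges n k" if "A \<in> \<A>" for A
    using that by (auto simp: \<A>_def complete_edges_def nsets_def)
  ultimately obtain \<sigma> where \<sigma>: "waiter_strategy (complete_edges n k) q \<sigma>"
    "\<And>h A. finished (complete_edges n k) q h \<Longrightarrow> follows_waiter \<sigma> h \<Longrightarrow> A \<in> \<A> \<Longrightarrow>
      A \<inter> client_elements h \<noteq> {}"
    using waiter_forces_transversal[OF r q finX _ _ small] by blast
  have "client_has_winning_set (NC2 n k) h"
    if h: "finished (complete_edges n k) q h" "follows_waiter \<sigma> h" for h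
  proof -
    let ?F = "client_elements h"
    have F: "?F \<subseteq> complete_edges n k"
      using h client_elements_subset by (auto simp: finished_def)
    have "\<not> weak_chromatic_number {..<n} ?F \<le> 2"
    proof
      assume "weak_chromatic_number {..<n} ?F \<le> 2"
      then obtain S where S: "S \<subseteq> {..<n}" "n \<le> 2 * card S" "independent_in ?F S"
        using large_independent_set[of "{..<n}" ?F k] F k n
        by (auto simp: complete_edges_def lessThan_empty_iff)
      obtain T where T: "T \<subseteq> S" "card T = m"
        using obtain_subset_with_card_n[OF m[OF S(2)]] by metis
      then have "T \<in> nsets {..<n} m"
        using S(1) by (auto simp: nsets_def intro: finite_subset)
      then have "nsets T k \<inter> ?F \<noteq> {}" using \<sigma>(2)[OF h] by (simp add: \<A>_def)
      then show False using S(3) T(1) by (fastforce simp: independent_in_def nsets_def)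
    qed
    then show ?thesis using client_has_winning_set_NC2_iff[OF k F] by simp
  qed
  then show ?thesis using \<sigma>(1) unfolding waiter_wins_def by blast
qed

section \<open>Counting estimates for dense edge configurations\<close>

lemma power_self_le_fact_exp: "real s ^ s \<le> fact s * exp 1 ^ s"
proof -
  have "real s ^ s / fact s \<le> exp (real s)"
  proof -
    \<comment> \<open>A single term of the exponential series is at most the whole series.\<close>
    have "(\<Sum>i\<in>{s}. inverse (fact i) *\<^sub>R real s ^ i) \<le> (\<Sum>i. inverse (fact i) *\<^sub>R real s ^ i)"
      by (intro sum_le_suminf summable_exp_generic) auto
    then show ?thesis by (simp add: exp_def divide_inverse mult.commute)
  qed
  also have "exp (real s) = exp 1 ^ s" by (simp flip: exp_of_nat_mult)
  finally show ?thesis by (simp add: field_simps)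
qed

text \<open>The ratio of the two binomial coefficients is a product of factors (s - i)/(n - i), each
  at most s/n. Cleared denominators keep the estimate in the naturals.\<close>

lemma choose_times_power_le:
  assumes "s \<le> n"
  shows "(s choose k) * n ^ k \<le> (n choose k) * s ^ k"
proof (induction k)
  case (Suc k)
  have "(s - k) * n \<le> (n - k) * s"
  proof (cases "k \<le> s")
    case True
    then show ?thesis using assms
      by (simp add: diff_mult_distrib mult.commute[of n s] diff_le_mono2)
  qed simp
  have absorb: "Suc k * (m choose Suc k) = (m - k) * (m choose k)" for m
    by (simp only: binomial_absorption binomial_absorb_comp)
  have "Suc k * ((s choose Suc k) * n ^ Suc k) = (Suc k * (s choose Suc k)) * n ^ Suc k"
    by (simp only: mult.assoc)
  also have "\<dots> = ((s choose k) * n ^ k) * ((s - k) * n)"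
    unfolding absorb by (simp add: mult_ac)
  also have "\<dots> \<le> ((n choose k) * s ^ k) * ((n - k) * s)"
    using Suc \<open>(s - k) * n \<le> (n - k) * s\<close> by (rule mult_le_mono)
  also have "\<dots> = (Suc k * (n choose Suc k)) * s ^ Suc k"
    unfolding absorb by (simp add: mult_ac)
  finally show ?case by (simp only: mult.assoc Suc_mult_le_cancel1)
qed simp

lemma choose_times_square_le:
  assumes "s \<le> n" "n \<ge> 1" "k \<ge> 2"
  shows "(s choose k) * n ^ 2 \<le> (n choose k) * s ^ 2"
proof -
  have k: "k = 2 + (k - 2)" using assms(3) by simp
  have "((s choose k) * n ^ 2) * n ^ (k - 2) \<le> (n choose k) * s ^ k"
    using choose_times_power_le[OF assms(1), of k] k by (metis mult.assoc power_add)
  also have "\<dots> = ((n choose k) * s ^ 2) * s ^ (k - 2)"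
    using k by (metis mult.assoc power_add)
  also have "\<dots> \<le> ((n choose k) * s ^ 2) * n ^ (k - 2)"
    using assms(1) by (intro mult_le_mono2 power_mono) auto
  finally show ?thesis using assms(2) by simp
qed

text \<open>With s! \<ge> (s/e)^s, both binomial coefficients together are at most (n * (s choose k)
  * e^2 / s^2)^s. The quadratic bound on s choose k cancels s^2 and leaves e^2 * (n choose k) / n,
  at most q/4 by hypothesis.\<close>

lemma dense_sets_bound:
  assumes s: "1 \<le> s" "s \<le> n" and k: "k \<ge> 2"
    and q: "4 * exp 1 ^ 2 * real (n choose k) \<le> real q * real n"
  shows "real (n choose s) * real ((s choose k) choose s) * (1 / real (q + 1)) ^ s \<le> (1 / 4) ^ s"
proof -
  let ?C = "s choose k" and ?D = "n choose k" and ?e = "exp 1 :: real"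
  let ?X = "real (n choose s)" and ?Y = "real (?C choose s)"
  have X: "?X * fact s \<le> real n ^ s" and Y: "?Y * fact s \<le> real ?C ^ s"
    using binomial_fact_pow[of n s] binomial_fact_pow[of ?C s]
    by (metis of_nat_fact of_nat_le_iff of_nat_mult of_nat_power)+
  have "real ?C * real n ^ 2 \<le> real ?D * real s ^ 2"
    using choose_times_square_le[OF s(2) _ k] s by (metis le_trans of_nat_le_iff of_nat_mult of_nat_power)
  then have "4 * ?e ^ 2 * (real ?C * real n ^ 2) \<le> 4 * ?e ^ 2 * (real ?D * real s ^ 2)"
    by (intro mult_left_mono) auto
  also have "\<dots> = (4 * ?e ^ 2 * real ?D) * real s ^ 2" by simp
  also have "\<dots> \<le> (real q * real n) * real s ^ 2" using q by (intro mult_right_mono) auto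
  finally have "real n * (4 * (real n * real ?C * ?e ^ 2)) \<le> real n * (real q * real s ^ 2)"
    by (simp add: algebra_simps power2_eq_square)
  then have base: "real n * real ?C * ?e ^ 2 \<le> (real q / 4) * real s ^ 2"
    using s by (subst (asm) mult_le_cancel_left) auto
  have "?X * ?Y * (real s ^ 2) ^ s = ?X * ?Y * (real s ^ s * real s ^ s)"
    by (simp add: power2_eq_square power_mult_distrib)
  also have "\<dots> \<le> ?X * ?Y * ((fact s * ?e ^ s) * (fact s * ?e ^ s))"
    using power_self_le_fact_exp[of s] by (intro mult_left_mono mult_mono) auto
  also have "\<dots> = (?X * fact s) * (?Y * fact s) * (?e ^ 2) ^ s"
    by (simp add: power2_eq_square power_mult_distrib algebra_simps)
  also have "\<dots> \<le> real n ^ s * real ?C ^ s * (?e ^ 2) ^ s"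
    using X Y by (intro mult_right_mono mult_mono) auto
  also have "\<dots> = (real n * real ?C * ?e ^ 2) ^ s" by (simp add: power_mult_distrib)
  also have "\<dots> \<le> ((real q / 4) * real s ^ 2) ^ s" using base by (intro power_mono) auto
  also have "\<dots> = (real q / 4) ^ s * (real s ^ 2) ^ s" by (rule power_mult_distrib)
  finally have "?X * ?Y \<le> (real q / 4) ^ s" using s by simp
  then have "?X * ?Y * (1 / real (q + 1)) ^ s \<le> (real q / 4) ^ s * (1 / real (q + 1)) ^ s"
    by (intro mult_right_mono) auto
  also have "\<dots> = ((real q / 4) * (1 / real (q + 1))) ^ s"
    by (rule power_mult_distrib[symmetric])
  also have "\<dots> \<le> (1 / 4) ^ s" by (intro power_mono) (auto simp: field_simps)
  finally show ?thesis .
qed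

lemma client_wins_NC2:
  assumes k: "k \<ge> 2" and q: "4 * exp 1 ^ 2 * real (n choose k) \<le> real q * real n"
  shows "client_wins (complete_edges n k) q (NC2 n k)"
proof -
  let ?X = "complete_edges n k" and ?p = "1 / real (q + 1)"
  \<comment> \<open>The s-edge configurations inside some s vertices, which Client avoids for every
    s from 1 to n.\<close>
  define D where "D = (\<lambda>s. \<Union>S\<in>nsets {..<n} s. nsets (nsets S k) s)"
  define \<W> where "\<W> = (\<Union>s\<in>{1..n}. D s)"
  have finX: "finite ?X" by (simp add: complete_edges_def finite_imp_finite_nsets)
  have finD: "finite (D s)" for s
    unfolding D_def
    by (intro finite_UN_I finite_imp_finite_nsets) (auto simp: nsets_def intro: finite_subset)
  have cardD: "card W = s" if "W \<in> D s" for W s using that by (auto simp: D_def nsets_def)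
  have num: "card (D s) \<le> (n choose s) * ((s choose k) choose s)" for s
  proof -
    have "card (D s) \<le> (\<Sum>S\<in>nsets {..<n} s. card (nsets (nsets S k) s))"
      unfolding D_def by (intro card_UN_le finite_imp_finite_nsets) simp
    also have "\<dots> = (\<Sum>S\<in>nsets {..<n} s. (s choose k) choose s)"
      by (intro sum.cong) (auto simp: nsets_def[of "{..<n}"])
    finally show ?thesis by simp
  qed
  have "(\<Sum>W\<in>\<W>. ?p ^ card W) = (\<Sum>s\<in>{1..n}. \<Sum>W\<in>D s. ?p ^ card W)"
    unfolding \<W>_def using finD by (intro sum.UNION_disjoint) (auto dest: cardD)
  also have "\<dots> = (\<Sum>s\<in>{1..n}. real (card (D s)) * ?p ^ s)"
    by (intro sum.cong refl) (simp add: cardD)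
  also have "\<dots> \<le> (\<Sum>s\<in>{1..n}. (1 / 4) ^ s)"
  proof (rule sum_mono)
    fix s assume s: "s \<in> {1..n}"
    have "real (card (D s)) \<le> real (n choose s) * real ((s choose k) choose s)"
      using num[of s] by (metis of_nat_le_iff of_nat_mult)
    then have "real (card (D s)) * ?p ^ s
        \<le> real (n choose s) * real ((s choose k) choose s) * ?p ^ s"
      by (intro mult_right_mono) auto
    also have "\<dots> \<le> (1 / 4) ^ s" using dense_sets_bound[OF _ _ k q] s by simp
    finally show "real (card (D s)) * ?p ^ s \<le> (1 / 4) ^ s" .
  qed
  also have "\<dots> = (1 - (1 / 4) ^ n) / 3" by (induction n) (simp_all add: diff_divide_distrib)
  also have "\<dots> < 1" by (simp add: add_pos_nonneg diff_less_eq)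
  finally have small: "(\<Sum>W\<in>\<W>. ?p ^ card W) < 1" .
  have "finite \<W>" using finD by (simp add: \<W>_def)
  moreover have "W \<subseteq> ?X" if "W \<in> \<W>" for W
    using that by (fastforce simp: \<W>_def D_def complete_edges_def nsets_def)
  ultimately obtain \<tau> where \<tau>: "client_strategy ?X q \<tau>"
    "\<And>h W. finished ?X q h \<Longrightarrow> follows_client \<tau> h \<Longrightarrow> W \<in> \<W> \<Longrightarrow> \<not> W \<subseteq> client_elements h"
    using client_avoids_sets[OF finX _ _ small] by blast
  have "\<not> client_has_winning_set (NC2 n k) h"
    if h: "finished ?X q h" "follows_client \<tau> h" for h
  proof -
    let ?F = "client_elements h"
    have F: "?F \<subseteq> ?X" using h client_elements_subset by (auto simp: finished_def)
    have expand: "card F' < card (\<Union>F')" if F': "F' \<subseteq> ?F" "F' \<noteq> {}" for F'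
    proof (rule ccontr)
      assume "\<not> ?thesis"
      \<comment> \<open>Surplus edges are discarded so that W has exactly as many edges as there are
        vertices in the union, as membership in \<open>D\<close> demands.\<close>
      then obtain W where W: "W \<subseteq> F'" "card W = card (\<Union>F')"
        using obtain_subset_with_card_n by (metis not_less)
      have edges: "e \<subseteq> {..<n}" "finite e" "card e = k" if "e \<in> F'" for e
        using that F' F by (auto simp: complete_edges_def nsets_def)
      have S: "\<Union>F' \<subseteq> {..<n}" using edges by blast
      then have finS: "finite (\<Union>F')" using finite_subset by blast
      obtain e where "e \<in> F'" using F'(2) by blast
      then have "k \<le> card (\<Union>F')"
        using edges(3)[of e] finS by (metis Union_upper card_mono)
      moreover have "card (\<Union>F') \<le> n" using card_mono[OF _ S] by simp
      ultimately have s: "card (\<Union>F') \<in> {1..n}" using k by simp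
      have "finite W" using W(1) F' F finX by (meson finite_subset)
      then have "W \<in> nsets (nsets (\<Union>F') k) (card (\<Union>F'))"
        using W edges by (auto simp: nsets_def)
      moreover have "\<Union>F' \<in> nsets {..<n} (card (\<Union>F'))" using S finS by (simp add: nsets_def)
      ultimately have "W \<in> \<W>" using s unfolding \<W>_def D_def by blast
      then show False using \<tau>(2)[OF h] W(1) F'(1) by blast
    qed
    have "finite e" if "e \<in> ?F" for e using that F by (auto simp: complete_edges_def nsets_def)
    then obtain R where "\<And>e. e \<in> ?F \<Longrightarrow> \<not> e \<subseteq> R \<and> e \<inter> R \<noteq> {}"
      using two_colouring_if_expanding[of ?F] expand finite_subset[OF F finX] by blast
    then have "weak_chromatic_number {..<n} ?F \<le> 2"
      using F by (intro weak_chromatic_number_le_2) (auto simp: complete_edges_def)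
    then show ?thesis using client_has_winning_set_NC2_iff[OF k F] by simp
  qed
  then show ?thesis using \<tau>(1) unfolding client_wins_def by blast
qed

text \<open>Already n \<ge> 1 suffices: each hypothesis on q implies the simpler one of
  \<open>waiter_wins_NC2\<close> or \<open>client_wins_NC2\<close>.\<close>

theorem theorem1p1:
  fixes k :: nat
  assumes "k \<ge> 2"
  shows "\<exists>n0. \<forall>n q :: nat. n \<ge> n0 \<and> q > 0 \<longrightarrow>
    (real q \<le> real (nat \<lceil>real n / 2\<rceil> choose k) * (ln 2 / (2 * ((1 + ln 2) * real n + ln 2)))
       \<longrightarrow> waiter_wins (complete_edges n k) q (NC2 n k)) \<and>
    (real q \<ge> 2 powr (real k / 2) * exp (real k / 2 + 1) * real k * real (n choose k) / real n
       \<longrightarrow> client_wins (complete_edges n k) q (NC2 n k))"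
proof (intro exI[of _ 1] allI impI conjI; elim conjE)
  fix n q :: nat
  let ?m = "nat \<lceil>real n / 2\<rceil>"
  assume n: "1 \<le> n" and q: "0 < q"
    and le: "real q \<le> real (?m choose k) * (ln 2 / (2 * ((1 + ln 2) * real n + ln 2)))"
  have ln2: "ln 2 > (0 :: real)" by simp
  have pos: "0 < 2 * ((1 + ln 2) * real n + ln 2)"
    using ln2 n by (simp add: add_pos_pos)
  \<comment> \<open>The right side exceeds the left by 2qn.\<close>
  have "ln 2 * real (q * (2 * n + 2)) \<le> real q * (2 * ((1 + ln 2) * real n + ln 2))"
    by (simp add: algebra_simps)
  also have "\<dots> \<le> ln 2 * real (?m choose k)"
    using le pos by (simp add: pos_le_divide_eq mult.commute)
  finally have "q * (2 * n + 2) \<le> ?m choose k"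
    using ln2 by (subst (asm) mult_le_cancel_left_pos) (auto simp only: of_nat_le_iff)
  moreover have "?m \<le> s" if "n \<le> 2 * s" for s
    using that by (simp add: nat_le_iff ceiling_le_iff)
  ultimately show "waiter_wins (complete_edges n k) q (NC2 n k)"
    using waiter_wins_NC2[OF assms n q] by blast
next
  fix n q :: nat
  assume n: "1 \<le> n"
    and ge: "real q \<ge> 2 powr (real k / 2) * exp (real k / 2 + 1) * real k * real (n choose k) / real n"
  \<comment> \<open>The constant 4e^2 is the value of 2^(k/2) * e^(k/2+1) * k at k = 2, and this
    expression increases with k.\<close>
  have "4 * exp 1 ^ 2 = 2 powr 1 * exp 2 * (2 :: real)" by (simp flip: exp_of_nat_mult)
  also have "\<dots> \<le> 2 powr (real k / 2) * exp (real k / 2 + 1) * real k"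
    using assms by (intro mult_mono powr_mono) auto
  finally have "4 * exp 1 ^ 2 * real (n choose k)
      \<le> 2 powr (real k / 2) * exp (real k / 2 + 1) * real k * real (n choose k)"
    by (intro mult_right_mono) auto
  also have "\<dots> \<le> real q * real n" using ge n by (simp add: pos_divide_le_eq)
  finally show "client_wins (complete_edges n k) q (NC2 n k)"
    by (rule client_wins_NC2[OF assms])
qed

end
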